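(* Let $\sigma\in(0,1/\lambda_{\max})$ and $k\in\{0,1,2,\ldots\}$. Then for all $z\in\mathcal{L}^\perp$ $$\|\sigma\mathbf{W}(k)z-z\|^2\leq(1-\sigma\lambda_{\min}^+)\|z\|^2 .$$
   Context: Let $\mathcal{V}=\{1,\ldots,n\}$, $\mathcal{L}=\{(x_1,\ldots,x_n)\in(\mathbb{R}^d)^{\mathcal{V}}:x_1=\cdots=x_n\}$, with orthogonal complement $\mathcal{L}^\perp=\{(z_1,\ldots,z_n)\in(\mathbb{R}^d)^{\mathcal{V}}:\sum_{i=1}^n z_i=0\}$. $\mathbf{P}=(\mathbf{I}_n-\frac1n\mathbf{1}_n\mathbf{1}_n^\top)\otimes\mathbf{I}_d$ is the orthogonal projector onto $\mathcal{L}^\perp$. Norms are Euclidean. For each $k\in\{0,1,2,\ldots\}$, $\mathcal{G}^k=(\mathcal{V},\mathcal{E}^k)$ is an undirected connected graph, and $\hat{\mathbf{W}}(k)\in\mathbb{R}^{n\times n}$ is a matrix such that: (1) it is symmetric positive semi-definite; (2) $\hat{\mathbf{W}}(k)_{i,j}\neq0$ if and only if $(i,j)\in\mathcal{E}^k$ or $i=j$; (3) $\ker\hat{\mathbf{W}}(k)=\{x\in\mathbb{R}^n:x_1=\cdots=x_n\}$. Put $\mathbf{W}(k)=\hat{\mathbf{W}}(k)\otimes\mathbf{I}_d$, acting on $(\mathbb{R}^d)^{\mathcal{V}}$. There are constants $0<\lambda_{\min}^+<\lambda_{\max}$ such that, for all $k$, the smallest positive eigenvalue of $\hat{\mathbf{W}}(k)$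 is at least $\lambda_{\min}^+$ and its largest eigenvalue is at most $\lambda_{\max}$; equivalently, $\lambda_{\min}^+\mathbf{P}\preceq\mathbf{W}(k)\preceq\lambda_{\max}\mathbf{P}$. *)

theory Defs
  imports "HOL-Analysis.Analysis" "Graph_Theory.Graph_Theory"
begin

definition eigenvalue :: "real^'n^'n \<Rightarrow> real \<Rightarrow> bool" where
  "eigenvalue A l \<longleftrightarrow> (\<exists>v. v \<noteq> 0 \<and> A *v v = l *\<^sub>R v)"

definition pos_semidef :: "real^'n^'n \<Rightarrow> bool" where
  "pos_semidef A \<longleftrightarrow> transpose A = A \<and> (\<forall>x. 0 \<le> x \<bullet> (A *v x))"

(* A symmetric matrix has finitely many eigenvalues (finite_eigenvalues below).  A nonzero
   positive semi-definite one has a positive eigenvalue, so that for such a matrix neither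
   Min nor Max is taken over an empty or infinite set. *)
definition smallest_pos_eigenvalue :: "real^'n^'n \<Rightarrow> real" where
  "smallest_pos_eigenvalue A = Min {l. eigenvalue A l \<and> 0 < l}"

definition largest_eigenvalue :: "real^'n^'n \<Rightarrow> real" where
  "largest_eigenvalue A = Max {l. eigenvalue A l}"

definition consensus :: "('a^'n) set" where
  "consensus = {x. \<forall>i j. x $ i = x $ j}"

definition kronecker :: "real^'m^'n \<Rightarrow> real^'q^'p \<Rightarrow> real^('m \<times> 'q)^('n \<times> 'p)" where
  "kronecker A B = (\<chi> r c. A $ fst r $ fst c * B $ snd r $ snd c)"

definition stack :: "(real^'d)^'n \<Rightarrow> real^('n \<times> 'd)" where
  "stack z = (\<chi> r. z $ fst r $ snd r)"

definition unstack :: "real^('n \<times> 'd) \<Rightarrow> (real^'d)^'n" where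
  "unstack y = (\<chi> i a. y $ (i, a))"

(* The Kronecker product of A with the identity on R^d, acting on n-tuples of vectors of R^d. *)
definition kron_id :: "real^'n^'n \<Rightarrow> (real^'d)^'n \<Rightarrow> (real^'d)^'n" where
  "kron_id A z = unstack (kronecker A (mat 1 :: real^'d^'d) *v stack z)"

lemma kron_id_nth: "kron_id A z $ i = (\<Sum>j\<in>UNIV. A $ i $ j *\<^sub>R z $ j)"
proof -
  have "kron_id A z $ i $ a = (\<Sum>j\<in>UNIV. A $ i $ j *\<^sub>R z $ j) $ a" for a
  proof -
    have "kron_id A z $ i $ a
        = (\<Sum>(j, b)\<in>UNIV \<times> UNIV. A $ i $ j * (if a = b then 1 else 0) * z $ j $ b)"
      by (simp add: kron_id_def unstack_def kronecker_def stack_def matrix_vector_mult_def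
          mat_def case_prod_unfold)
    also have "\<dots> = (\<Sum>j\<in>UNIV. \<Sum>b\<in>UNIV. if a = b then A $ i $ j * z $ j $ b else 0)"
      by (subst sum.cartesian_product[symmetric]) (intro sum.cong refl, simp)
    also have "\<dots> = (\<Sum>j\<in>UNIV. A $ i $ j *\<^sub>R z $ j) $ a"
      by (simp add: sum_component)
    finally show ?thesis .
  qed
  then show ?thesis by (simp add: vec_eq_iff)
qed

lemma norm_stack: "norm (stack z) = norm z"
proof -
  have "stack z \<bullet> stack z = (\<Sum>(i, a)\<in>UNIV \<times> UNIV. z $ i $ a * z $ i $ a)"
    by (simp add: inner_vec_def stack_def case_prod_unfold)
  also have "\<dots> = z \<bullet> z"
    by (subst sum.cartesian_product[symmetric]) (simp add: inner_vec_def)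
  finally show ?thesis by (simp add: norm_eq_sqrt_inner)
qed

lemma orthogonal_comp_consensus:
  "(consensus :: ((real^'d)^'n) set)\<^sup>\<bottom> = {z. (\<Sum>i\<in>UNIV. z $ i) = 0}"
proof (intro set_eqI iffI)
  fix z :: "(real^'d)^'n"
  assume z: "z \<in> consensus\<^sup>\<bottom>"
  let ?s = "\<Sum>i\<in>UNIV. z $ i"
  have "(\<chi> i. ?s) \<in> (consensus :: ((real^'d)^'n) set)" by (simp add: consensus_def)
  with z have "(\<chi> i. ?s) \<bullet> z = 0" by (auto simp: orthogonal_comp_def orthogonal_def)
  then have "?s \<bullet> ?s = 0" by (simp add: inner_vec_def[of "\<chi> i. ?s"] inner_sum_right)
  then show "z \<in> {z. (\<Sum>i\<in>UNIV. z $ i) = 0}" by simp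
next
  fix z :: "(real^'d)^'n"
  assume z: "z \<in> {z. (\<Sum>i\<in>UNIV. z $ i) = 0}"
  have "y \<bullet> z = 0" if "y \<in> consensus" for y
  proof -
    define c where "c = y $ undefined"
    have "y $ i = c" for i using that by (simp add: consensus_def c_def)
    then have "y \<bullet> z = c \<bullet> (\<Sum>i\<in>UNIV. z $ i)"
      by (simp add: inner_vec_def[of y] inner_sum_right)
    with z show ?thesis by simp
  qed
  then show "z \<in> consensus\<^sup>\<bottom>" by (simp add: orthogonal_comp_def orthogonal_def)
qed

lemma finite_eigenvalues:
  assumes "transpose A = A"
  shows "finite {l. eigenvalue A l}"
proof -
  let ?S = "{l. eigenvalue A l}"
  have "\<forall>l\<in>?S. \<exists>v. v \<noteq> 0 \<and> A *v v = l *\<^sub>R v"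
    by (simp add: eigenvalue_def)
  from bchoice[OF this] obtain v where v: "\<forall>l\<in>?S. v l \<noteq> 0 \<and> A *v v l = l *\<^sub>R v l" ..
  have orth: "v l \<bullet> v m = 0" if "l \<in> ?S" "m \<in> ?S" "l \<noteq> m" for l m
  proof -
    have "l * (v l \<bullet> v m) = (A *v v l) \<bullet> v m"
      using v that(1) by simp
    also have "\<dots> = v l \<bullet> (A *v v m)"
      using dot_lmul_matrix[of "v l" "transpose A" "v m"] assms
      unfolding vector_transpose_matrix by simp
    also have "\<dots> = m * (v l \<bullet> v m)"
      using v that(2) by simp
    finally show ?thesis using that(3) by simp
  qed
  have inj: "inj_on v ?S"
  proof (rule inj_onI, rule ccontr)
    fix l m assume lm: "l \<in> ?S" "m \<in> ?S" "v l = v m" "l \<noteq> m"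
    from orth[OF lm(1,2,4)] lm(3) have "v m = 0" by simp
    with v lm(2) show False by blast
  qed
  have "pairwise orthogonal (v ` ?S)"
    using orth by (auto simp: pairwise_def orthogonal_def)
  moreover have "0 \<notin> v ` ?S" using v by (metis imageE)
  ultimately have "finite (v ` ?S)"
    using pairwise_orthogonal_independent independent_imp_finite by blast
  from this inj show ?thesis by (rule finite_imageD)
qed

end

theory Submission
  imports Defs
begin

text \<open>
  On \<open>\<L>\<^sup>\<bottom>\<close> the eigenvalues \<open>\<mu>\<close> of \<open>W\<close> lie between \<open>lam_min\<close> and \<open>lam_max\<close>, so those of \<open>\<sigma>W - I\<close> lie in
  the interval from \<open>-(1 - \<sigma> lam_min)\<close> to \<open>0\<close>, and \<open>(1 - \<sigma>\<mu>)\<^sup>2 \<le> 1 - \<sigma>\<mu> \<le> 1 - \<sigma> lam_min\<close>.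
  Instead of diagonalising \<open>W\<close>, the proof works with quadratic forms.  Expanding the square gives
  \<open>\<parallel>\<sigma>Wz - z\<parallel>\<^sup>2 = \<parallel>z\<parallel>\<^sup>2 - 2\<sigma>\<langle>z, Wz\<rangle> + \<sigma>\<^sup>2\<parallel>Wz\<parallel>\<^sup>2\<close>, so it suffices to know that
  \<open>\<parallel>Wz\<parallel>\<^sup>2 \<le> lam_max \<langle>z, Wz\<rangle>\<close> and \<open>\<langle>z, Wz\<rangle> \<ge> lam_min \<parallel>z\<parallel>\<^sup>2\<close>.

  Both follow from two facts about a self-adjoint operator on a finite-dimensional space.  The first
  is the Cauchy-Schwarz inequality for the semi-inner product that a positive semi-definite
  operator defines (\<open>semidefinite_Cauchy_Schwarz\<close>).  The second is that the quadratic form, restricted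
  to the unit sphere of an invariant subspace, attains its minimum at an eigenvector
  (\<open>Rayleigh_minimum_eigenvector\<close>).  Applied to the orthogonal complement of the kernel, where no
  eigenvalue vanishes, it bounds the form below by the smallest positive eigenvalue; applied to the
  negated operator on the whole space, it bounds the form above by the largest eigenvalue.

  The Kronecker product with the identity acts separately on each of the \<open>d\<close> coordinate slices of
  \<open>z\<close>, and squared norms add up over the slices, so the case \<open>d = 1\<close> yields the general one.
\<close>

section \<open>Extremal eigenvectors of self-adjoint operators\<close>

text \<open>
  The usual argument: the quadratic \<open>t \<mapsto> \<langle>x + ty, f (x + ty)\<rangle>\<close> is nonnegative.  Positivity is asked
  for on a subspace only, because a shifted operator \<open>f - l I\<close> can be semi-definite on an invariant
  subspace without being so on the whole space.
\<close>
lemma semidefinite_Cauchy_Schwarz: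
  fixes f :: "'a::real_inner \<Rightarrow> 'a"
  assumes lin: "linear f"
    and sym: "\<And>x y. f x \<bullet> y = x \<bullet> f y"
    and V: "subspace V"
    and nonneg: "\<And>x. x \<in> V \<Longrightarrow> 0 \<le> x \<bullet> f x"
    and x: "x \<in> V" and y: "y \<in> V"
  shows "(x \<bullet> f y)\<^sup>2 \<le> (x \<bullet> f x) * (y \<bullet> f y)"
proof -
  define a b c where "a = x \<bullet> f x" and "b = x \<bullet> f y" and "c = y \<bullet> f y"
  have quad: "0 \<le> a + 2 * t * b + t\<^sup>2 * c" for t
  proof -
    have "x + t *\<^sub>R y \<in> V" using V x y by (simp add: subspace_add subspace_scale)
    from nonneg[OF this] have "0 \<le> (x + t *\<^sub>R y) \<bullet> (f x + t *\<^sub>R f y)"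
      by (simp add: linear_add[OF lin] linear_scale[OF lin])
    moreover have "y \<bullet> f x = b"
      unfolding b_def using sym[of x y] by (simp add: inner_commute)
    ultimately show ?thesis
      by (simp add: a_def b_def c_def inner_add_left inner_add_right power2_eq_square algebra_simps)
  qed
  have "b\<^sup>2 \<le> a * c"
  proof (cases "c = 0")
    case True
    have "b = 0"
    proof (rule ccontr)
      assume "b \<noteq> 0"
      \<comment> \<open>Here the quadratic is affine in \<open>t\<close>, and this is where it takes the value \<open>-1\<close>.\<close>
      then show False using quad[of "- (a + 1) / (2 * b)"] True by (simp add: field_simps)
    qed
    then show ?thesis using True by simp
  next
    case False
    then have "0 < c" using nonneg[OF y] by (simp add: c_def)
    \<comment> \<open>The minimum of the quadratic is at \<open>t = - b / c\<close>.\<close>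
    then show ?thesis using quad[of "- b / c"] by (simp add: power2_eq_square field_simps)
  qed
  then show ?thesis by (simp add: a_def b_def c_def)
qed

text \<open>
  Let \<open>v\<close> minimise the form on the unit sphere of \<open>V\<close>, with minimum \<open>l\<close>.  Then \<open>f - l I\<close> is positive
  semi-definite on \<open>V\<close> and its form vanishes at \<open>v\<close>, so by Cauchy-Schwarz \<open>f v - l v\<close> is orthogonal
  to all of \<open>V\<close>.  Invariance of \<open>V\<close> makes it an element of \<open>V\<close>, hence zero.
\<close>
lemma Rayleigh_minimum_eigenvector:
  fixes f :: "'a::euclidean_space \<Rightarrow> 'a"
  assumes lin: "linear f"
    and sym: "\<And>x y. f x \<bullet> y = x \<bullet> f y"
    and V: "subspace V"
    and invariant: "\<And>x. x \<in> V \<Longrightarrow> f x \<in> V"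
    and nontrivial: "w \<in> V" "w \<noteq> 0"
  obtains v l where "v \<in> V" "v \<noteq> 0" "f v = l *\<^sub>R v"
    and "\<And>x. x \<in> V \<Longrightarrow> l * (x \<bullet> x) \<le> x \<bullet> f x"
proof -
  let ?S = "sphere 0 1 \<inter> V"
  have "compact ?S"
    using closed_subspace[OF V] by (simp add: compact_Int_closed)
  moreover have "w /\<^sub>R norm w \<in> ?S"
    using nontrivial V by (simp add: subspace_scale)
  moreover have "continuous_on ?S (\<lambda>x. x \<bullet> f x)"
    using linear_continuous_on[OF lin[unfolded linear_conv_bounded_linear]]
    by (intro continuous_on_inner continuous_on_id)
  ultimately obtain v where v: "v \<in> ?S" and min: "\<And>u. u \<in> ?S \<Longrightarrow> v \<bullet> f v \<le> u \<bullet> f u"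
    using continuous_attains_inf[of ?S "\<lambda>x. x \<bullet> f x"] by blast
  define l where "l = v \<bullet> f v"
  have bound: "l * (x \<bullet> x) \<le> x \<bullet> f x" if "x \<in> V" for x
  proof (cases "x = 0")
    case True
    then show ?thesis by simp
  next
    case False
    let ?u = "x /\<^sub>R norm x"
    have "?u \<in> ?S" using that False V by (simp add: subspace_scale)
    then have "l \<le> ?u \<bullet> f ?u" unfolding l_def by (rule min)
    also have "\<dots> = (x \<bullet> f x) / (norm x)\<^sup>2"
      by (simp add: linear_scale[OF lin] power2_eq_square divide_simps)
    finally show ?thesis using False by (simp add: power2_norm_eq_inner field_simps)
  qed
  define g where "g x = f x - l *\<^sub>R x" for x
  have "linear g"
    unfolding g_def by (intro linear_compose_sub lin linear_scale_self)
  moreover have "g x \<bullet> y = x \<bullet> g y" for x y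
    by (simp add: g_def inner_diff_left inner_diff_right sym)
  moreover have "0 \<le> x \<bullet> g x" if "x \<in> V" for x
    using bound[OF that] by (simp add: g_def inner_diff_right)
  moreover have v': "v \<in> V" "v \<bullet> v = 1"
    using v by (auto simp: norm_eq_1)
  moreover have gv: "g v \<in> V"
    unfolding g_def using V invariant v' by (simp add: subspace_diff subspace_scale)
  ultimately have "(g v \<bullet> g v)\<^sup>2 \<le> (g v \<bullet> g (g v)) * (v \<bullet> g v)"
    by (intro semidefinite_Cauchy_Schwarz[OF _ _ V])
  moreover have "v \<bullet> g v = 0" by (simp add: g_def inner_diff_right l_def v')
  ultimately have "g v = 0" by simp
  then have "f v = l *\<^sub>R v" by (simp add: g_def)
  moreover have "v \<noteq> 0" using v' by auto
  ultimately show thesis using that[OF v'(1)] bound by blast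
qed

section \<open>Spectral bounds for positive semi-definite matrices\<close>

lemma symmetric_matrix_inner:
  fixes A :: "real^'n^'n"
  assumes "transpose A = A"
  shows "(A *v x) \<bullet> y = x \<bullet> (A *v y)"
  using dot_lmul_matrix[of x "transpose A" y] assms unfolding vector_transpose_matrix by simp

text \<open>
  The orthogonal complement of the kernel is invariant and meets the kernel only in \<open>0\<close>, so the
  minimal eigenvalue there is one of the positive eigenvalues of \<open>A\<close>.
\<close>
lemma smallest_pos_eigenvalue_bound:
  fixes A :: "real^'n^'n"
  assumes psd: "pos_semidef A"
    and x: "x \<in> {x. A *v x = 0}\<^sup>\<bottom>"
  shows "smallest_pos_eigenvalue A * (x \<bullet> x) \<le> x \<bullet> (A *v x)"
proof (cases "x = 0")
  case True
  then show ?thesis by simp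
next
  case False
  let ?V = "{x. A *v x = 0}\<^sup>\<bottom>"
  have sym: "transpose A = A" and nonneg: "\<And>x. 0 \<le> x \<bullet> (A *v x)"
    using psd by (auto simp: pos_semidef_def)
  have invariant: "A *v u \<in> ?V" for u
    by (simp add: orthogonal_comp_def orthogonal_def flip: symmetric_matrix_inner[OF sym])
  obtain v l where v: "v \<in> ?V" "v \<noteq> 0" "A *v v = l *\<^sub>R v"
    and bound: "\<And>u. u \<in> ?V \<Longrightarrow> l * (u \<bullet> u) \<le> u \<bullet> (A *v u)"
    by (rule Rayleigh_minimum_eigenvector[OF matrix_vector_mul_linear symmetric_matrix_inner[OF sym]
        subspace_orthogonal_comp invariant x False]) (rule that)
  have "0 \<le> l * (v \<bullet> v)" using nonneg[of v] v by simp
  moreover have "0 < v \<bullet> v" using v(2) by simp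
  ultimately have "0 \<le> l" by (simp add: zero_le_mult_iff)
  moreover have "l \<noteq> 0"
  proof
    assume "l = 0"
    then have "A *v v = 0" using v(3) by simp
    then have "v \<bullet> v = 0" using v(1) by (auto simp: orthogonal_comp_def orthogonal_def)
    then show False using v(2) by simp
  qed
  ultimately have "l \<in> {l. eigenvalue A l \<and> 0 < l}"
    using v by (auto simp: eigenvalue_def)
  moreover have "finite {l. eigenvalue A l \<and> 0 < l}"
    using finite_eigenvalues[OF sym] by (rule rev_finite_subset) auto
  ultimately have "smallest_pos_eigenvalue A \<le> l"
    unfolding smallest_pos_eigenvalue_def by (intro Min_le)
  then have "smallest_pos_eigenvalue A * (x \<bullet> x) \<le> l * (x \<bullet> x)"
    by (intro mult_right_mono) auto
  also have "\<dots> \<le> x \<bullet> (A *v x)" by (rule bound[OF x])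
  finally show ?thesis .
qed

lemma largest_eigenvalue_bound:
  fixes A :: "real^'n^'n"
  assumes sym: "transpose A = A"
  shows "x \<bullet> (A *v x) \<le> largest_eigenvalue A * (x \<bullet> x)"
proof (cases "x = 0")
  case True
  then show ?thesis by simp
next
  case False
  have lin: "linear (\<lambda>u. - (A *v u))"
    by (intro linear_compose_neg matrix_vector_mul_linear)
  have adj: "(- (A *v u)) \<bullet> w = u \<bullet> (- (A *v w))" for u w
    by (simp add: symmetric_matrix_inner[OF sym])
  obtain v l where v: "v \<in> UNIV" "v \<noteq> 0" "- (A *v v) = l *\<^sub>R v"
    and bound: "\<And>u. u \<in> UNIV \<Longrightarrow> l * (u \<bullet> u) \<le> u \<bullet> (- (A *v u))"
    by (rule Rayleigh_minimum_eigenvector[OF lin adj subspace_UNIV UNIV_I UNIV_I False]) (rule that)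
  have "A *v v = (- l) *\<^sub>R v" using arg_cong[OF v(3), of uminus] by simp
  then have "eigenvalue A (- l)" using v(2) by (auto simp: eigenvalue_def)
  then have "- l \<le> largest_eigenvalue A"
    unfolding largest_eigenvalue_def using finite_eigenvalues[OF sym] by (intro Max_ge) auto
  then have "(- l) * (x \<bullet> x) \<le> largest_eigenvalue A * (x \<bullet> x)"
    by (intro mult_right_mono) auto
  then show ?thesis using bound[of x] by simp
qed

text \<open>
  This is \<open>A\<^sup>2 \<preceq> L A\<close>, obtained without a square root of \<open>A\<close>: in the semi-inner product of \<open>A\<close>,
  \<open>\<parallel>Ax\<parallel>\<^sup>2\<close> is the product of \<open>x\<close> with \<open>Ax\<close>, and the upper bound on \<open>A\<close> controls the second factor that
  Cauchy-Schwarz produces.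
\<close>
lemma norm_image_le_quadratic_form:
  fixes A :: "real^'n^'n"
  assumes psd: "pos_semidef A" and L: "largest_eigenvalue A \<le> L"
  shows "(A *v x) \<bullet> (A *v x) \<le> L * (x \<bullet> (A *v x))"
proof (cases "A *v x = 0")
  case True
  then show ?thesis by simp
next
  case False
  let ?y = "A *v x"
  have sym: "transpose A = A" and nonneg: "\<And>x. 0 \<le> x \<bullet> (A *v x)"
    using psd by (auto simp: pos_semidef_def)
  have "(?y \<bullet> ?y)\<^sup>2 = (x \<bullet> (A *v ?y))\<^sup>2"
    by (simp add: symmetric_matrix_inner[OF sym])
  also have "\<dots> \<le> (x \<bullet> ?y) * (?y \<bullet> (A *v ?y))"
    using symmetric_matrix_inner[OF sym] nonneg
    by (intro semidefinite_Cauchy_Schwarz[OF matrix_vector_mul_linear _ subspace_UNIV]) auto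
  also have "\<dots> \<le> (x \<bullet> ?y) * (L * (?y \<bullet> ?y))"
  proof (rule mult_left_mono[OF _ nonneg])
    have "?y \<bullet> (A *v ?y) \<le> largest_eigenvalue A * (?y \<bullet> ?y)"
      by (rule largest_eigenvalue_bound[OF sym])
    also have "\<dots> \<le> L * (?y \<bullet> ?y)" using L by (intro mult_right_mono) auto
    finally show "?y \<bullet> (A *v ?y) \<le> L * (?y \<bullet> ?y)" .
  qed
  finally have "(?y \<bullet> ?y) * (?y \<bullet> ?y) \<le> (L * (x \<bullet> ?y)) * (?y \<bullet> ?y)"
    by (simp add: power2_eq_square mult_ac)
  then show ?thesis using False by simp
qed

section \<open>Contraction of a gradient step\<close>

text \<open>
  Both spectral bounds enter through the quadratic form \<open>\<langle>x, Ax\<rangle>\<close>: the step size makes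
  \<open>\<sigma>\<^sup>2\<parallel>Ax\<parallel>\<^sup>2\<close> at most \<open>\<sigma>\<langle>x, Ax\<rangle>\<close>, which uses up one half of the cross term \<open>- 2\<sigma>\<langle>x, Ax\<rangle>\<close>; the other
  half produces the contraction.
\<close>
lemma gradient_step_contraction:
  fixes A :: "real^'n^'n"
  assumes psd: "pos_semidef A"
    and x: "x \<in> {x. A *v x = 0}\<^sup>\<bottom>"
    and m: "m \<le> smallest_pos_eigenvalue A"
    and L: "largest_eigenvalue A \<le> L"
    and \<sigma>: "0 \<le> \<sigma>" "\<sigma> * L \<le> 1"
  shows "(norm (\<sigma> *\<^sub>R (A *v x) - x))\<^sup>2 \<le> (1 - \<sigma> * m) * (norm x)\<^sup>2"
proof -
  let ?q = "x \<bullet> (A *v x)"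
  have q: "0 \<le> ?q" using psd by (simp add: pos_semidef_def)
  have "\<sigma>\<^sup>2 * ((A *v x) \<bullet> (A *v x)) \<le> \<sigma>\<^sup>2 * (L * ?q)"
    by (intro mult_left_mono norm_image_le_quadratic_form psd L) simp
  also have "\<dots> = (\<sigma> * L) * (\<sigma> * ?q)" by (simp add: power2_eq_square)
  also have "\<dots> \<le> \<sigma> * ?q" using \<sigma> q mult_right_mono[of "\<sigma> * L" 1 "\<sigma> * ?q"] by simp
  finally have upper: "\<sigma>\<^sup>2 * ((A *v x) \<bullet> (A *v x)) \<le> \<sigma> * ?q" .
  have "m * (x \<bullet> x) \<le> smallest_pos_eigenvalue A * (x \<bullet> x)"
    using m by (intro mult_right_mono) auto
  also have "\<dots> \<le> ?q" by (rule smallest_pos_eigenvalue_bound[OF psd x])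
  finally have lower: "\<sigma> * (m * (x \<bullet> x)) \<le> \<sigma> * ?q" using \<sigma> by (intro mult_left_mono)
  have "(norm (\<sigma> *\<^sub>R (A *v x) - x))\<^sup>2
      = \<sigma>\<^sup>2 * ((A *v x) \<bullet> (A *v x)) - 2 * (\<sigma> * ?q) + x \<bullet> x"
    unfolding power2_norm_eq_inner
    by (simp add: inner_diff_left inner_diff_right inner_commute power2_eq_square algebra_simps)
  also have "\<dots> \<le> x \<bullet> x - \<sigma> * (m * (x \<bullet> x))" using upper lower by linarith
  also have "\<dots> = (1 - \<sigma> * m) * (norm x)\<^sup>2"
    by (simp add: power2_norm_eq_inner algebra_simps)
  finally show ?thesis .
qed

section \<open>Coordinate slices\<close>

definition slice :: "'d \<Rightarrow> (real^'d)^'n \<Rightarrow> real^'n" where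
  "slice a z = (\<chi> i. z $ i $ a)"

lemma slice_diff: "slice a (y - z) = slice a y - slice a z"
  by (simp add: slice_def vec_eq_iff)

lemma slice_scaleR: "slice a (c *\<^sub>R z) = c *\<^sub>R slice a z"
  by (simp add: slice_def vec_eq_iff)

lemma slice_kron_id: "slice a (kron_id A z) = A *v slice a z"
  by (simp add: slice_def vec_eq_iff kron_id_nth matrix_vector_mult_def sum_component)

lemma norm_square_slices: "(norm z)\<^sup>2 = (\<Sum>a\<in>UNIV. (norm (slice a z))\<^sup>2)"
proof -
  have "z \<bullet> z = (\<Sum>i\<in>UNIV. \<Sum>a\<in>UNIV. z $ i $ a * z $ i $ a)"
    by (simp add: inner_vec_def)
  also have "\<dots> = (\<Sum>a\<in>UNIV. \<Sum>i\<in>UNIV. z $ i $ a * z $ i $ a)"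
    by (rule sum.swap)
  also have "\<dots> = (\<Sum>a\<in>UNIV. slice a z \<bullet> slice a z)"
    by (simp add: inner_vec_def slice_def)
  finally show ?thesis by (simp add: power2_norm_eq_inner)
qed

lemma slice_orthogonal_consensus:
  fixes z :: "(real^'d)^'n"
  assumes "z \<in> consensus\<^sup>\<bottom>"
  shows "slice a z \<in> consensus\<^sup>\<bottom>"
proof -
  have "(\<Sum>i\<in>UNIV. z $ i) = 0"
    using assms by (simp add: orthogonal_comp_consensus)
  then have sum0: "(\<Sum>i\<in>UNIV. z $ i $ a) = 0" by (metis sum_component zero_index)
  have "y \<bullet> slice a z = 0" if "y \<in> consensus" for y
  proof -
    define c where "c = y $ undefined"
    have "y $ i = c" for i using that by (simp add: consensus_def c_def)
    then have "y \<bullet> slice a z = c * (\<Sum>i\<in>UNIV. z $ i $ a)"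
      by (simp add: inner_vec_def slice_def sum_distrib_left mult.commute)
    then show ?thesis using sum0 by simp
  qed
  then show ?thesis by (simp add: orthogonal_comp_def orthogonal_def)
qed

theorem lemma1:
  fixes G :: "nat \<Rightarrow> 'n::finite pair_pre_digraph"
    and What :: "nat \<Rightarrow> real^'n^'n"
    and lam_min lam_max \<sigma> :: real
    and k :: nat
    and z :: "(real^'d::finite)^'n"
  assumes graph: "\<And>k. pair_graph (G k)"
    and verts: "\<And>k. pverts (G k) = UNIV"
    and conn: "\<And>k. Digraph_Component.connected (with_proj (G k))"
    and psd: "\<And>k. pos_semidef (What k)"
    and pattern: "\<And>k i j. What k $ i $ j \<noteq> 0 \<longleftrightarrow> (i, j) \<in> parcs (G k) \<or> i = j"
    and kernel: "\<And>k. {x. What k *v x = 0} = consensus"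
    and lam: "0 < lam_min" "lam_min < lam_max"
    and smallest: "\<And>k. lam_min \<le> smallest_pos_eigenvalue (What k)"
    and largest: "\<And>k. largest_eigenvalue (What k) \<le> lam_max"
    and sigma: "\<sigma> \<in> {0<..<1 / lam_max}"
    and z: "z \<in> consensus\<^sup>\<bottom>"
  shows "(norm (\<sigma> *\<^sub>R kron_id (What k) z - z))\<^sup>2 \<le> (1 - \<sigma> * lam_min) * (norm z)\<^sup>2"
proof -
  have "pos_semidef (What k)" by (rule psd)
  moreover have "slice a z \<in> {x. What k *v x = 0}\<^sup>\<bottom>" for a
    unfolding kernel by (rule slice_orthogonal_consensus[OF z])
  moreover have "0 \<le> \<sigma>" "\<sigma> * lam_max \<le> 1"
    using sigma lam by (auto simp: field_simps)
  ultimately have "(norm (\<sigma> *\<^sub>R (What k *v slice a z) - slice a z))\<^sup>2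
      \<le> (1 - \<sigma> * lam_min) * (norm (slice a z))\<^sup>2" for a
    using smallest largest by (intro gradient_step_contraction)
  then show ?thesis
    unfolding norm_square_slices slice_diff slice_scaleR slice_kron_id sum_distrib_left
    by (rule sum_mono)
qed

end
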